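(* Let $n\ge1$, $0\le r\le n+1$, and let $G^r_n$ be a graph obtained from the linear crossed polyomino chain $G_n$ by deleting $r$ of its vertical edges. Let $L(G^r_n)$ be its Laplacian matrix, and let $L_{11}$ (resp. $L_{12}$) be the $(n+1)\times(n+1)$ submatrix of $L(G^r_n)$ with rows indexed by $1,\ldots,n+1$ and columns indexed by $1,\ldots,n+1$ (resp. by $1',\ldots,(n+1)'$, in this order). Let $\zeta_1\le\cdots\le\zeta_{n+1}$ be the eigenvalues of $L_S(G^r_n)=L_{11}-L_{12}$. Then, with $d=d_1+d_{n+1}$ where $d_1,d_{n+1}$ are the degrees of vertices $1$ and $n+1$ in $G^r_n$, $$\sum_{j=1}^{n+1}\frac1{\zeta_j}=\frac{2n+r-2d+16}{12},\qquad \prod_{j=1}^{n+1}\zeta_j=2^{\,n+r+2d-9}\cdot 3^{\,n-r-d+5}.$$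
   Context: For $n\geq1$, $G_n$ is the simple graph with vertex set $\{1,\ldots,n+1\}\cup\{1',\ldots,(n+1)'\}$ and edge set consisting of the vertical edges $ii'$ for $1\le i\le n+1$ together with, for each $1\le i\le n$, the edges $i(i+1)$, $i'(i+1)'$, $i(i+1)'$, $i'(i+1)$. For $0\le r\le n+1$, $\mathcal{G}^r_n$ is the set of graphs obtained from $G_n$ by deleting exactly $r$ of the vertical edges $ii'$; $G^r_n$ denotes any member of $\mathcal{G}^r_n$. The Laplacian is $L=D-A$. *)

theory Defs
  imports Complex_Main "Jordan_Normal_Form.Char_Poly"
begin

text \<open>A finite simple graph is given by its vertex set and its set of edges, an edge being
  a two-element set of vertices.\<close>

record 'v sgraph =
  verts :: "'v set"
  edges :: "'v set set"

definition vdegree :: "'v sgraph \<Rightarrow> 'v \<Rightarrow> nat" where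
  "vdegree G v = card {e \<in> edges G. v \<in> e}"

text \<open>Matrices of a graph are indexed by vertices, so no enumeration of the vertices is needed.\<close>

definition degree_matrix :: "'v sgraph \<Rightarrow> 'v \<Rightarrow> 'v \<Rightarrow> real" where
  "degree_matrix G u v = (if u = v then real (vdegree G u) else 0)"

definition adjacency_matrix :: "'v sgraph \<Rightarrow> 'v \<Rightarrow> 'v \<Rightarrow> real" where
  "adjacency_matrix G u v = (if {u, v} \<in> edges G then 1 else 0)"

definition laplacian :: "'v sgraph \<Rightarrow> 'v \<Rightarrow> 'v \<Rightarrow> real" where
  "laplacian G u v = degree_matrix G u v - adjacency_matrix G u v"

text \<open>The submatrix with rows and columns taken along given lists of indices, in list order.\<close>

definition submat_along :: "('v \<Rightarrow> 'v \<Rightarrow> real) \<Rightarrow> 'v list \<Rightarrow> 'v list \<Rightarrow> real mat" where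
  "submat_along M us vs = mat (length us) (length vs) (\<lambda>(i, j). M (us ! i) (vs ! j))"

text \<open>\<open>Vtx i\<close> is the vertex $i$ and \<open>Vtx' i\<close> is the vertex $i'$.\<close>

datatype vertex = Vtx nat | Vtx' nat

definition vertical_edges :: "nat \<Rightarrow> vertex set set" where
  "vertical_edges n = {{Vtx i, Vtx' i} | i. 1 \<le> i \<and> i \<le> n + 1}"

definition crossed_chain :: "nat \<Rightarrow> vertex sgraph" where
  "crossed_chain n = \<lparr>
     verts = Vtx ` {1..n + 1} \<union> Vtx' ` {1..n + 1},
     edges = vertical_edges n
       \<union> {{Vtx i, Vtx (i + 1)} | i. 1 \<le> i \<and> i \<le> n}
       \<union> {{Vtx' i, Vtx' (i + 1)} | i. 1 \<le> i \<and> i \<le> n}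
       \<union> {{Vtx i, Vtx' (i + 1)} | i. 1 \<le> i \<and> i \<le> n}
       \<union> {{Vtx' i, Vtx (i + 1)} | i. 1 \<le> i \<and> i \<le> n}\<rparr>"

definition deleted_chains :: "nat \<Rightarrow> nat \<Rightarrow> vertex sgraph set" where
  "deleted_chains n r =
     {\<lparr>verts = verts (crossed_chain n), edges = edges (crossed_chain n) - D\<rparr> | D.
        D \<subseteq> vertical_edges n \<and> card D = r}"

definition L11 :: "nat \<Rightarrow> vertex sgraph \<Rightarrow> real mat" where
  "L11 n G = submat_along (laplacian G) (map Vtx [1..<n + 2]) (map Vtx [1..<n + 2])"

definition L12 :: "nat \<Rightarrow> vertex sgraph \<Rightarrow> real mat" where
  "L12 n G = submat_along (laplacian G) (map Vtx [1..<n + 2]) (map Vtx' [1..<n + 2])"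

definition L_S :: "nat \<Rightarrow> vertex sgraph \<Rightarrow> real mat" where
  "L_S n G = L11 n G - L12 n G"

text \<open>\<open>\<zeta> 1 \<le> \<dots> \<le> \<zeta> m\<close> are the eigenvalues of the \<open>m \<times> m\<close> matrix \<open>A\<close>, listed with
  algebraic multiplicity; values of \<open>\<zeta>\<close> outside \<open>{1..m}\<close> are irrelevant. Such a \<open>\<zeta>\<close> exists
  for every real symmetric \<open>A\<close>.\<close>

definition ordered_eigenvalues :: "real mat \<Rightarrow> (nat \<Rightarrow> real) \<Rightarrow> bool" where
  "ordered_eigenvalues A \<zeta> \<longleftrightarrow>
     mono_on {1..dim_row A} \<zeta> \<and> char_poly A = (\<Prod>j = 1..dim_row A. [:- \<zeta> j, 1:])"

end

theory Submission imports Defs begin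

text \<open>The horizontal and crossed edges contribute the same off-diagonal entries to \<open>L11\<close> and
  \<open>L12\<close>, so \<open>L_S\<close> is diagonal: its entry at \<open>i\<close> is the degree of \<open>i\<close>, increased by 1 if \<open>i i'\<close> is
  an edge. The eigenvalues are therefore 6 and 4 in the interior (vertical edge kept, deleted) and
  4 and 2 at the two ends, and counting the deleted edges gives the sum and the product.\<close>

text \<open>Over an integral domain the multiset \<open>proots\<close> of a product of monic linear
  factors is exactly the multiset of the values that define the factors. This is what later
  identifies the eigenvalues with the diagonal entries, up to order.\<close>

lemma prod_linear_factors_eq_imp_image_mset_eq:
  fixes f :: "'a \<Rightarrow> 'c::idom" and g :: "'b \<Rightarrow> 'c"
  assumes "finite A" "finite B" and eq: "(\<Prod>x\<in>A. [:- f x, 1:]) = (\<Prod>x\<in>B. [:- g x, 1:])"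
  shows "image_mset f (mset_set A) = image_mset g (mset_set B)"
proof -
  have *: "proots (\<Prod>x\<in>C. [:- h x, 1:]) = image_mset h (mset_set C)" if "finite C"
    for C :: "'d set" and h :: "'d \<Rightarrow> 'c"
    using that by (subst proots_prod) (simp_all, induction C rule: finite_induct, auto)
  show ?thesis
    using *[OF assms(1), of f] *[OF assms(2), of g] eq by simp
qed

context
  fixes n :: nat and D :: "vertex set set" and G :: "vertex sgraph"
  assumes D: "D \<subseteq> vertical_edges n"
    and G: "G = \<lparr>verts = verts (crossed_chain n), edges = edges (crossed_chain n) - D\<rparr>"
begin

definition deleted_indices :: "nat set" where
  "deleted_indices = {i. {Vtx i, Vtx' i} \<in> D}"

text \<open>Members of \<open>D\<close> join some \<open>Vtx i\<close> to \<open>Vtx' i\<close>, so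
  no edge between two unprimed vertices is lost.\<close>

lemma Vtx_Vtx_in_edges_iff:
  "{Vtx i, Vtx j} \<in> edges G \<longleftrightarrow> 1 \<le> i \<and> 1 \<le> j \<and> i \<le> n + 1 \<and> j \<le> n + 1 \<and> (j = i + 1 \<or> i = j + 1)"
  using D by (auto simp: G crossed_chain_def vertical_edges_def doubleton_eq_iff)

lemma Vtx_Vtx'_in_edges_iff:
  "{Vtx i, Vtx' j} \<in> edges G \<longleftrightarrow> 1 \<le> i \<and> 1 \<le> j \<and> i \<le> n + 1 \<and> j \<le> n + 1 \<and>
     (j = i + 1 \<or> i = j + 1 \<or> i = j \<and> i \<notin> deleted_indices)"
  using D by (auto simp: G crossed_chain_def vertical_edges_def doubleton_eq_iff deleted_indices_def)

text \<open>An edge at \<open>Vtx i\<close> determines its other endpoint, so incident edges and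
  neighbours correspond bijectively.\<close>

lemma vdegree_eq_card_neighbours: "vdegree G (Vtx i) = card {u. {Vtx i, u} \<in> edges G}"
proof -
  have "\<exists>u. e = {Vtx i, u}" if "e \<in> edges G" "Vtx i \<in> e" for e
    using that by (auto simp: G crossed_chain_def vertical_edges_def)
  then have "{e \<in> edges G. Vtx i \<in> e} = (\<lambda>u. {Vtx i, u}) ` {u. {Vtx i, u} \<in> edges G}"
    by blast
  moreover have "inj_on (\<lambda>u. {Vtx i, u}) {u. {Vtx i, u} \<in> edges G}"
    by (auto simp: inj_on_def doubleton_eq_iff)
  ultimately show ?thesis
    by (simp add: vdegree_def card_image)
qed

lemma vdegree_Vtx:
  assumes "n \<ge> 1" "1 \<le> i" "i \<le> n + 1"
  shows "vdegree G (Vtx i) =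
    (if i = 1 \<or> i = n + 1 then 2 else 4) + (if i \<in> deleted_indices then 0 else 1)"
proof -
  \<comment> \<open>\<open>N\<close> holds the positions next to \<open>i\<close> on the chain. Each
    gives two neighbours, one unprimed and one primed, whereas the vertical edge, recorded by
    \<open>N'\<close>, gives only one. Hence the degree is \<open>2 * card N + card N'\<close>,
    where \<open>N\<close> has one element at an end and two elsewhere.\<close>
  define N where "N = (if i \<le> n then {i + 1} else {}) \<union> (if i > 1 then {i - 1} else {})"
  define N' where "N' = (if i \<in> deleted_indices then {} else {i})"
  have "{u. {Vtx i, u} \<in> edges G} = Vtx ` N \<union> Vtx' ` (N \<union> N')" (is "?L = ?R")
  proof (rule Set.set_eqI)
    show "u \<in> ?L \<longleftrightarrow> u \<in> ?R" for u
      using assms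
      by (cases u)
        (auto simp: N_def N'_def image_iff Vtx_Vtx_in_edges_iff[simplified]
          Vtx_Vtx'_in_edges_iff[simplified])
  qed
  moreover have "card (Vtx ` N \<union> Vtx' ` (N \<union> N')) = card (Vtx ` N) + card (Vtx' ` (N \<union> N'))"
    by (intro card_Un_disjoint) (auto simp: N_def N'_def)
  moreover have "card (N \<union> N') = card N + card N'"
    by (intro card_Un_disjoint) (auto simp: N_def N'_def)
  ultimately have "vdegree G (Vtx i) = 2 * card N + card N'"
    by (simp add: vdegree_eq_card_neighbours card_image inj_on_def)
  then show ?thesis
    using assms by (auto simp: N_def N'_def card_insert_if)
qed

text \<open>A surviving vertical edge counts twice: once in the degree, and once because its entry
  -1 in \<open>L12\<close> is subtracted.\<close>

definition diag_entry :: "nat \<Rightarrow> real" where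
  "diag_entry i = (if i = 1 \<or> i = n + 1 then 2 else 4) + (if i \<in> deleted_indices then 0 else 2)"

text \<open>Matrix indices start at 0 and vertex numbers at 1, hence the \<open>Suc\<close>.\<close>

lemma L_S_eq_diagonal:
  assumes "n \<ge> 1"
  shows "L_S n G = mat (n + 1) (n + 1) (\<lambda>(i, j). if i = j then diag_entry (Suc i) else 0)"
  unfolding L_S_def L11_def L12_def submat_along_def
  using assms
  by (intro eq_matI)
    (auto simp: laplacian_def degree_matrix_def adjacency_matrix_def vdegree_Vtx diag_entry_def
      Vtx_Vtx_in_edges_iff[simplified] Vtx_Vtx'_in_edges_iff[simplified] nth_append
      simp del: upt_Suc)

lemma char_poly_L_S:
  assumes "n \<ge> 1"
  shows "char_poly (L_S n G) = (\<Prod>j = 1..n + 1. [:- diag_entry j, 1:])"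
proof -
  define M where "M = mat (n + 1) (n + 1) (\<lambda>(i, j). if i = j then diag_entry (Suc i) else 0)"
  have "char_poly M = (\<Prod>a\<leftarrow>diag_mat M. [:- a, 1:])"
    by (rule char_poly_upper_triangular[of _ "n + 1"]) (auto simp: M_def)
  also have "diag_mat M = map (\<lambda>i. diag_entry (Suc i)) [0..<n + 1]"
    by (auto simp: diag_mat_def M_def simp del: upt_Suc)
  also have "(\<Prod>a\<leftarrow>\<dots>. [:- a, 1:]) = (\<Prod>i = 0..<n + 1. [:- diag_entry (Suc i), 1:])"
    by (simp add: o_def prod.distinct_set_conv_list[symmetric] del: upt_Suc prod.op_ivl_Suc)
  also have "\<dots> = (\<Prod>j = 1..n + 1. [:- diag_entry j, 1:])"
    by (rule prod.reindex_bij_witness[of _ "\<lambda>j. j - 1" Suc]) auto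
  finally show ?thesis
    using L_S_eq_diagonal[OF assms] by (simp add: M_def)
qed

lemma deleted_indices_subset: "deleted_indices \<subseteq> {1..n + 1}"
  using D by (auto simp: deleted_indices_def vertical_edges_def doubleton_eq_iff)

lemma card_deleted_indices: "card deleted_indices = card D"
proof -
  have "D = (\<lambda>i. {Vtx i, Vtx' i}) ` deleted_indices"
    using D by (auto simp: deleted_indices_def vertical_edges_def)
  moreover have "inj_on (\<lambda>i. {Vtx i, Vtx' i}) deleted_indices"
    by (auto simp: inj_on_def doubleton_eq_iff)
  ultimately show ?thesis
    by (metis card_image)
qed

text \<open>Both sides depend only on the numbers of kept and deleted vertical edges in the interior
  and on the status of the two ends. These four numbers determine \<open>n\<close>, \<open>r\<close>
  and \<open>d\<close> linearly.\<close>

lemma sum_prod_diag_entry: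
  assumes n: "n \<ge> 1"
    and d: "d = vdegree G (Vtx 1) + vdegree G (Vtx (n + 1))"
    and r: "r = card D"
  shows "(\<Sum>j = 1..n + 1. 1 / diag_entry j) = (2 * real n + real r - 2 * real d + 16) / 12"
    and "(\<Prod>j = 1..n + 1. diag_entry j)
      = 2 powi (int n + int r + 2 * int d - 9) * 3 powi (int n - int r - int d + 5)"
proof -
  define P where "P = {2..n} \<inter> deleted_indices"
  define Q where "Q = {2..n} - deleted_indices"
  define s t :: nat where "s = of_bool (1 \<in> deleted_indices)" "t = of_bool (n + 1 \<in> deleted_indices)"
  have fin: "finite P" "finite Q" and disj: "P \<inter> Q = {}" and PQ: "{2..n} = P \<union> Q"
    by (auto simp: P_def Q_def)
  have ivl: "{1..n + 1} = insert 1 (insert (n + 1) (P \<union> Q))"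
    using n unfolding PQ[symmetric] by auto
  have notin: "1 \<notin> insert (n + 1) (P \<union> Q)" "n + 1 \<notin> P \<union> Q"
    using n unfolding PQ[symmetric] by auto
  have len: "card P + card Q + 1 = n"
    using card_Un_disjoint[OF fin disj] n unfolding PQ[symmetric] by simp
  \<comment> \<open>The deleted positions are counted separately at the two ends, which are distinct
    as \<open>n \<ge> 1\<close>, and in the interior.\<close>
  have "deleted_indices = (deleted_indices \<inter> {1}) \<union> (deleted_indices \<inter> {n + 1}) \<union> P"
    using deleted_indices_subset unfolding P_def by fastforce
  then have "card deleted_indices
      = card ((deleted_indices \<inter> {1}) \<union> (deleted_indices \<inter> {n + 1}) \<union> P)"
    by simp
  also have "\<dots> = card ((deleted_indices \<inter> {1}) \<union> (deleted_indices \<inter> {n + 1})) + card P"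
    by (intro card_Un_disjoint) (auto simp: P_def)
  also have "card ((deleted_indices \<inter> {1}) \<union> (deleted_indices \<inter> {n + 1}))
      = card (deleted_indices \<inter> {1}) + card (deleted_indices \<inter> {n + 1})"
    using n by (intro card_Un_disjoint) auto
  also have "\<dots> = s + t"
    by (auto simp: s_t_def)
  finally have r': "r = s + t + card P"
    using r card_deleted_indices by simp
  \<comment> \<open>The ends have degrees \<open>3 - s\<close> and \<open>3 - t\<close>.\<close>
  have d': "d + s + t = 6"
    using n unfolding d by (subst (1 2) vdegree_Vtx) (auto simp: s_t_def)
  have entries: "diag_entry 1 = 4 - 2 * real s" "diag_entry (n + 1) = 4 - 2 * real t"
    "\<And>j. j \<in> P \<Longrightarrow> diag_entry j = 4" "\<And>j. j \<in> Q \<Longrightarrow> diag_entry j = 6"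
    by (auto simp: diag_entry_def s_t_def P_def Q_def)
  have st: "s = 0 \<or> s = 1" "t = 0 \<or> t = 1"
    by (auto simp: s_t_def)
  have "(\<Sum>j = 1..n + 1. 1 / diag_entry j)
      = 1 / diag_entry 1 + (1 / diag_entry (n + 1) + (real (card P) / 4 + real (card Q) / 6))"
    unfolding ivl using fin disj notin by (simp add: sum.union_disjoint entries(3,4))
  also have "\<dots> = 1 / (4 - 2 * real s) + (1 / (4 - 2 * real t) + (real (card P) / 4 + real (card Q) / 6))"
    by (simp only: entries(1,2))
  \<comment> \<open>For \<open>s\<close> in {0, 1} the reciprocal of \<open>4 - 2 * s\<close> is the
    linear expression \<open>(1 + s) / 4\<close>, and likewise for \<open>t\<close>; so both sides
    are linear in the counts.\<close>
  also have "\<dots> = (2 * real n + real r - 2 * real d + 16) / 12"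
    using st d' unfolding r' len[symmetric] by (auto simp: field_simps)
  finally show "(\<Sum>j = 1..n + 1. 1 / diag_entry j) = (2 * real n + real r - 2 * real d + 16) / 12" .
  have "(\<Prod>j = 1..n + 1. diag_entry j)
      = diag_entry 1 * (diag_entry (n + 1) * (4 ^ card P * 6 ^ card Q))"
    unfolding ivl using fin disj notin by (simp add: prod.union_disjoint entries(3,4))
  \<comment> \<open>The values 4 and 2 at an end are powers of 2, so only the entries 6 contribute
    factors 3, one for each element of \<open>Q\<close>.\<close>
  also have "diag_entry 1 = 2 ^ (2 - s)"
    using st(1) entries(1) by auto
  also have "diag_entry (n + 1) = 2 ^ (2 - t)"
    using st(2) entries(2) by auto
  also have "2 ^ (2 - s) * (2 ^ (2 - t) * (4 ^ card P * 6 ^ card Q))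
      = 2 ^ ((2 - s) + (2 - t) + 2 * card P + card Q) * (3::real) ^ card Q"
    by (simp add: power_add power_mult flip: power_mult_distrib)
  also have "\<dots> = 2 powi int ((2 - s) + (2 - t) + 2 * card P + card Q) * 3 powi int (card Q)"
    by (simp only: power_int_of_nat)
  also have "int ((2 - s) + (2 - t) + 2 * card P + card Q) = int n + int r + 2 * int d - 9"
    using st d' unfolding r' len[symmetric] by auto
  also have "int (card Q) = int n - int r - int d + 5"
    using d' unfolding r' len[symmetric] by auto
  finally show "(\<Prod>j = 1..n + 1. diag_entry j)
      = 2 powi (int n + int r + 2 * int d - 9) * 3 powi (int n - int r - int d + 5)" .
qed

end

theorem theorem4p1:
  fixes n r d :: nat and G :: "vertex sgraph" and \<zeta> :: "nat \<Rightarrow> real"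
  assumes "n \<ge> 1" and "r \<le> n + 1"
    and "G \<in> deleted_chains n r"
    and "ordered_eigenvalues (L_S n G) \<zeta>"
    and "d = vdegree G (Vtx 1) + vdegree G (Vtx (n + 1))"
  shows "(\<Sum>j = 1..n + 1. 1 / \<zeta> j) = (2 * real n + real r - 2 * real d + 16) / 12
    \<and> (\<Prod>j = 1..n + 1. \<zeta> j)
        = 2 powi (int n + int r + 2 * int d - 9) * 3 powi (int n - int r - int d + 5)"
proof -
  obtain D where D: "D \<subseteq> vertical_edges n" "r = card D"
    "G = \<lparr>verts = verts (crossed_chain n), edges = edges (crossed_chain n) - D\<rparr>"
    using assms(3) by (auto simp: deleted_chains_def)
  have "dim_row (L_S n G) = n + 1"
    by (simp add: L_S_def L12_def submat_along_def)
  then have "(\<Prod>j = 1..n + 1. [:- \<zeta> j, 1:]) = (\<Prod>j = 1..n + 1. [:- diag_entry n D j, 1:])"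
    using assms(4) char_poly_L_S[OF D(1,3) assms(1)] by (simp add: ordered_eigenvalues_def)
  then have mset: "image_mset \<zeta> (mset_set {1..n + 1}) = image_mset (diag_entry n D) (mset_set {1..n + 1})"
    by (intro prod_linear_factors_eq_imp_image_mset_eq) auto
  \<comment> \<open>Equal multisets have equal sums under every \<open>h\<close>; the reciprocal is
    the instance needed.\<close>
  have "(\<Sum>j = 1..n + 1. h (\<zeta> j)) = (\<Sum>j = 1..n + 1. h (diag_entry n D j))" for h :: "real \<Rightarrow> real"
    using arg_cong[OF mset, of "\<lambda>M. \<Sum>x\<in>#M. h x"]
    by (simp add: sum_unfold_sum_mset multiset.map_comp o_def)
  moreover have "(\<Prod>j = 1..n + 1. \<zeta> j) = (\<Prod>j = 1..n + 1. diag_entry n D j)"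
    using arg_cong[OF mset, of prod_mset] by (simp add: prod_unfold_prod_mset)
  ultimately show ?thesis
    using sum_prod_diag_entry[OF D(1,3) assms(1,5) D(2)] by metis
qed

end
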